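(* Let $G$ be a graph and $G'$ an induced minor of $G$. Then $\mathsf{tree}\text{-}\alpha(G')\le\mathsf{tree}\text{-}\alpha(G)$.
   Context: All graphs are finite, simple, and undirected. An edge contraction is the operation of deleting a pair of adjacent vertices and replacing them with a new vertex whose neighborhood is the union of the neighborhoods of the two original vertices (among the remaining vertices). A graph $G'$ is an induced minor of $G$ if $G'$ can be obtained from $G$ by a sequence of vertex deletions and edge contractions. A tree decomposition of a graph $G$ is a pair $\mathcal{T}=(T,\{X_t\}_{t\in V(T)})$ where $T$ is a tree and each node $t$ is assigned a bag $X_t\subseteq V(G)$ such that every vertex of $G$ is in at least one bag, every edge of $G$ has both endpoints in some common bag, and for every $u\in V(G)$ the subgraph of $T$ induced by $\{t: u\in X_t\}$ is connected. The independence number of $\mathcal{T}$ is $\alpha(\mathcal{T})=\max_{t\in V(T)}\alpha(G[X_t])$, where $\alpha(H)$ is the maximum size of an independent set in $H$. The tree-independence number $\mathsf{tree}\text{-}\alpha(G)$ is the minimum of $\alpha(\mathcal{T})$ over all tree decompositions $\mathcal{T}$ of $G$. *)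

theory Defs
  imports "Graph_Theory.Digraph_Isomorphism"
begin

text \<open>
  Finite simple undirected graphs are represented by \<^const>\<open>pair_graph\<close>: a finite vertex set and a
  symmetric irreflexive set of arcs, an edge \<open>uv\<close> being the two arcs \<open>(u, v)\<close> and \<open>(v, u)\<close>.
\<close>

definition neighbours :: "'a pair_pre_digraph \<Rightarrow> 'a \<Rightarrow> 'a set" where
  "neighbours G u = {x. (u, x) \<in> parcs G}"

definition delete_vertex :: "'a pair_pre_digraph \<Rightarrow> 'a \<Rightarrow> 'a pair_pre_digraph" where
  "delete_vertex G v =
    \<lparr> pverts = pverts G - {v}, parcs = {(x, y) \<in> parcs G. x \<noteq> v \<and> y \<noteq> v} \<rparr>"

definition contract_edge :: "'a pair_pre_digraph \<Rightarrow> 'a \<Rightarrow> 'a \<Rightarrow> 'a \<Rightarrow> 'a pair_pre_digraph" where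
  "contract_edge G u v w =
    \<lparr> pverts = insert w (pverts G - {u, v}),
      parcs = {(x, y) \<in> parcs G. x \<notin> {u, v} \<and> y \<notin> {u, v}}
        \<union> {w} \<times> (neighbours G u \<union> neighbours G v - {u, v})
        \<union> (neighbours G u \<union> neighbours G v - {u, v}) \<times> {w} \<rparr>"

text \<open>
  The new vertex \<open>w\<close> of a contraction must differ from all remaining vertices. It may reuse the name
  \<open>u\<close> or \<open>v\<close>, so that every edge can be contracted even if the vertex type is finite.
\<close>

inductive induced_minor_step :: "'a pair_pre_digraph \<Rightarrow> 'a pair_pre_digraph \<Rightarrow> bool" for G where
  deletion: "v \<in> pverts G \<Longrightarrow> induced_minor_step G (delete_vertex G v)"
| contraction: "(u, v) \<in> parcs G \<Longrightarrow> w \<notin> pverts G - {u, v} \<Longrightarrow>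
    induced_minor_step G (contract_edge G u v w)"

text \<open>
  Graphs are identified up to isomorphism; this also lets \<open>G'\<close> have a vertex type of its own.
\<close>

definition induced_minor :: "'b pair_pre_digraph \<Rightarrow> 'a pair_pre_digraph \<Rightarrow> bool" where
  "induced_minor G' G \<longleftrightarrow>
    (\<exists>H. induced_minor_step\<^sup>*\<^sup>* G H \<and> digraph_iso (with_proj H) (with_proj G'))"

definition independent_set :: "('a, 'b) pre_digraph \<Rightarrow> 'a set \<Rightarrow> bool" where
  "independent_set G S \<longleftrightarrow> S \<subseteq> verts G \<and> (\<forall>u\<in>S. \<forall>v\<in>S. \<not> u \<rightarrow>\<^bsub>G\<^esub> v)"

definition independence_number :: "('a, 'b) pre_digraph \<Rightarrow> nat" where
  "independence_number G = Max (card ` {S. independent_set G S})"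

text \<open>
  The library's \<^const>\<open>forest\<close> and \<^const>\<open>tree\<close> are not usable here: in a symmetric digraph they count
  the closed walk \<open>u, v, u\<close> along a single edge as a cycle. Cycles of simple graphs have length at
  least 3. Note that \<^const>\<open>connected\<close> includes that there is at least one vertex.
\<close>

definition undirected_tree :: "'t pair_pre_digraph \<Rightarrow> bool" where
  "undirected_tree T \<longleftrightarrow> pair_graph T \<and> connected (with_proj T) \<and>
    \<not> (\<exists>p. pre_digraph.cycle (with_proj T) p \<and> 3 \<le> length p)"

definition tree_decomposition ::
    "'a pair_pre_digraph \<Rightarrow> 't pair_pre_digraph \<Rightarrow> ('t \<Rightarrow> 'a set) \<Rightarrow> bool" where
  "tree_decomposition G T X \<longleftrightarrow>
    undirected_tree T \<and>
    (\<forall>t\<in>pverts T. X t \<subseteq> pverts G) \<and>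
    (\<forall>u\<in>pverts G. \<exists>t\<in>pverts T. u \<in> X t) \<and>
    (\<forall>(u, v)\<in>parcs G. \<exists>t\<in>pverts T. u \<in> X t \<and> v \<in> X t) \<and>
    (\<forall>u\<in>pverts G. connected (with_proj T \<restriction> {t \<in> pverts T. u \<in> X t}))"

definition decomposition_alpha ::
    "'a pair_pre_digraph \<Rightarrow> 't pair_pre_digraph \<Rightarrow> ('t \<Rightarrow> 'a set) \<Rightarrow> nat" where
  "decomposition_alpha G T X =
    Max ((\<lambda>t. independence_number (with_proj G \<restriction> X t)) ` pverts T)"

text \<open>
  Trees are finite, so it is no restriction to draw their nodes from \<^typ>\<open>nat\<close>; see
  \<open>tree_alpha_le\<close> below, where the node type is arbitrary.
\<close>

definition tree_alpha :: "'a pair_pre_digraph \<Rightarrow> nat" where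
  "tree_alpha G =
    (LEAST k. \<exists>(T :: nat pair_pre_digraph) X.
      tree_decomposition G T X \<and> k = decomposition_alpha G T X)"

lemma tree_decomposition_exists:
  fixes G :: "'a pair_pre_digraph"
  assumes "pair_graph G"
  shows "\<exists>(T :: nat pair_pre_digraph) X. tree_decomposition G T X"
proof -
  interpret G: pair_graph G by fact
  let ?T = "\<lparr> pverts = {0::nat}, parcs = {} \<rparr>"
  have g: "pair_graph ?T"
    by unfold_locales (auto simp: symmetric_def sym_def)
  then interpret T: pair_graph ?T .
  have c: "connected (with_proj ?T)"
    by (auto simp: connected_def strongly_connected_def mk_symmetric_def reachable_def
        intro: rtrancl_on.intros)
  have nc: "\<not> (\<exists>p. pre_digraph.cycle (with_proj ?T) p \<and> 3 \<le> length p)"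
  proof
    assume "\<exists>p. pre_digraph.cycle (with_proj ?T) p \<and> 3 \<le> length p"
    then obtain p where p: "pre_digraph.cycle (with_proj ?T) p" "p \<noteq> []"
      by fastforce
    then show False
      by (auto simp: pre_digraph.cycle_def pre_digraph.awalk_def)
  qed
  have r: "connected (with_proj ?T \<restriction> {0})"
    by (auto simp: connected_def strongly_connected_def mk_symmetric_def reachable_def
        intro: rtrancl_on.intros)
  have "tree_decomposition G ?T (\<lambda>_. pverts G)"
    using g c nc r by (auto simp: tree_decomposition_def undirected_tree_def dest: G.in_arcsD1 G.in_arcsD2)
  then show ?thesis by blast
qed

lemma tree_alpha_attained:
  fixes G :: "'a pair_pre_digraph"
  assumes "pair_graph G"
  shows "\<exists>(T :: nat pair_pre_digraph) X.
    tree_decomposition G T X \<and> tree_alpha G = decomposition_alpha G T X"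
  unfolding tree_alpha_def
  by (rule LeastI_ex) (use tree_decomposition_exists[OF assms] in blast)

lemma tree_alpha_le:
  fixes G :: "'a pair_pre_digraph" and T :: "'t pair_pre_digraph"
  assumes td: "tree_decomposition G T X"
  shows "tree_alpha G \<le> decomposition_alpha G T X"
proof -
  from td have tree: "undirected_tree T"
    by (simp add: tree_decomposition_def)
  then have T: "pair_graph T"
    by (simp add: undirected_tree_def)
  interpret T: pair_graph T by fact
  obtain f :: "'t \<Rightarrow> nat" where inj: "inj_on f (pverts T)"
    using finite_imp_inj_to_nat_seg[OF T.pair_finite_verts] by blast
  define h :: "('t, 't \<times> 't, nat, nat \<times> nat) digraph_isomorphism" where
    "h = \<lparr> iso_verts = f, iso_arcs = map_prod f f, iso_head = snd, iso_tail = fst \<rparr>"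
  define T' where "T' = \<lparr> pverts = f ` pverts T, parcs = map_prod f f ` parcs T \<rparr>"
  define X' where "X' = X \<circ> the_inv_into (pverts T) f"
  have X'f: "X' (f t) = X t" if "t \<in> pverts T" for t
    using inj that by (simp add: X'_def the_inv_into_f_f)
  have inj2: "inj_on (map_prod f f) (parcs T)"
    by (rule inj_on_subset[OF map_prod_inj_on[OF inj inj]]) (auto dest: T.in_arcsD1 T.in_arcsD2)
  have iso: "pre_digraph.digraph_isomorphism (with_proj T) h"
    using inj inj2 T.wf_digraph by (simp add: pre_digraph.digraph_isomorphism_def h_def)
  have app: "with_proj T' = app_iso h (with_proj T)"
    by (simp add: app_iso_def h_def T'_def with_proj_def)
  have T': "pair_graph T'"
  proof unfold_locales
    show "symmetric (with_proj T')"
      unfolding symmetric_def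
    proof (rule symI)
      fix a b assume "(a, b) \<in> arcs_ends (with_proj T')"
      then obtain x y where "a = f x" "b = f y" "(x, y) \<in> parcs T"
        by (auto simp: T'_def)
      then show "(b, a) \<in> arcs_ends (with_proj T')"
        using T.arcs_symmetric[of x y] by (auto simp: T'_def intro: rev_image_eqI)
    qed
  next
    fix e assume "e \<in> parcs T'"
    then obtain x y where xy: "e = (f x, f y)" "(x, y) \<in> parcs T"
      by (auto simp: T'_def)
    then show "fst e \<noteq> snd e"
      using inj_on_eq_iff[OF inj] T.in_arcsD1 T.in_arcsD2 T.no_loops' by fastforce
  qed (auto simp: T'_def dest: T.in_arcsD1 T.in_arcsD2)
  have con: "connected (with_proj T' \<restriction> f ` S)" if S: "connected (with_proj T \<restriction> S)" "S \<subseteq> pverts T" for S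
  proof -
    have "app_iso h (with_proj T \<restriction> S) = with_proj T' \<restriction> f ` S"
    proof (intro pre_digraph.equality)
      show "arcs (app_iso h (with_proj T \<restriction> S)) = arcs (with_proj T' \<restriction> f ` S)"
      proof -
        have "f (fst e) \<in> f ` S \<longleftrightarrow> fst e \<in> S" "f (snd e) \<in> f ` S \<longleftrightarrow> snd e \<in> S"
          if "e \<in> parcs T" for e
          using inj_on_image_mem_iff[OF inj _ S(2)] that
          by (auto intro: T.arc_fst_in_verts T.arc_snd_in_verts)
        then have "{e \<in> parcs T. fst e \<in> S \<and> snd e \<in> S}
            = {e \<in> parcs T. f (fst e) \<in> f ` S \<and> f (snd e) \<in> f ` S}"
          by blast
        moreover have "g ` {e \<in> A. Q (g e)} = {e \<in> g ` A. Q e}"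
          for g :: "'t \<times> 't \<Rightarrow> nat \<times> nat" and A Q
          by blast
        from this[of "map_prod f f" "parcs T" "\<lambda>e. fst e \<in> f ` S \<and> snd e \<in> f ` S"]
        have "map_prod f f ` {e \<in> parcs T. f (fst e) \<in> f ` S \<and> f (snd e) \<in> f ` S}
            = {e \<in> map_prod f f ` parcs T. fst e \<in> f ` S \<and> snd e \<in> f ` S}"
          by simp
        ultimately show ?thesis
          by (simp add: h_def T'_def)
      qed
    qed (auto simp: h_def)
    moreover have "pre_digraph.digraph_isomorphism (with_proj T \<restriction> S) h"
      using inj inj2 S(2) by (auto simp: pre_digraph.digraph_isomorphism_def h_def
          T.wellformed_induce_subgraph intro: inj_on_subset)
    moreover have "wf_digraph (with_proj T \<restriction> S)"
      by (rule T.wellformed_induce_subgraph)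
    ultimately show ?thesis
      using S(1) wf_digraph.connectedI_app_iso by metis
  qed
  have cyc: "\<exists>q. pre_digraph.cycle (with_proj T) q \<and> length q = length p"
    if p: "pre_digraph.cycle (with_proj T') p" for p
  proof -
    interpret T': pair_graph T' by fact
    let ?g = "pre_digraph.inv_iso (with_proj T) h"
    have g: "pre_digraph.digraph_isomorphism (with_proj T') ?g"
      using T.digraph_isomorphism_invI[OF iso] by (simp add: app)
    have gT: "app_iso ?g (with_proj T') = with_proj T"
      using T.app_iso_inv[OF iso] by (simp add: app)
    from p obtain u where u: "pre_digraph.awalk (with_proj T') u p u"
        "distinct (tl (pre_digraph.awalk_verts (with_proj T') u p))" "p \<noteq> []"
      by (auto simp: pre_digraph.cycle_def)
    let ?u = "iso_verts ?g u" and ?q = "map (iso_arcs ?g) p"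
    have w: "pre_digraph.awalk (with_proj T) ?u ?q ?u"
      using T'.awalk_app_isoI[OF u(1) g] by (simp add: gT)
    have v: "pre_digraph.awalk_verts (with_proj T) ?u ?q
        = map (iso_verts ?g) (pre_digraph.awalk_verts (with_proj T') u p)"
      using T'.awalk_verts_app_iso_eq[OF g] u(1) by (auto simp: gT)
    have "set (pre_digraph.awalk_verts (with_proj T') u p) \<subseteq> pverts T'"
      using T'.awalk_verts_in_verts u(1) by (auto simp: T'.awalk_def)
    moreover have "set (tl xs) \<subseteq> set xs" for xs :: "nat list"
      by (cases xs) auto
    ultimately have "inj_on (iso_verts ?g) (set (tl (pre_digraph.awalk_verts (with_proj T') u p)))"
      using T'.digraph_isomorphism_inj_on_verts[OF g] by (meson inj_on_subset)
    then have "distinct (tl (pre_digraph.awalk_verts (with_proj T) ?u ?q))"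
      using u(2) unfolding v map_tl[symmetric] distinct_map by simp
    with w u(3) show ?thesis
      by (auto simp: pre_digraph.cycle_def intro!: exI[of _ ?q] exI[of _ ?u])
  qed
  have full: "with_proj T \<restriction> pverts T = with_proj T" "with_proj T' \<restriction> f ` pverts T = with_proj T'"
    by (auto intro!: pre_digraph.equality imageI simp: T'_def dest: T.in_arcsD1 T.in_arcsD2)
  have tree': "undirected_tree T'"
    using tree T' con[of "pverts T"] cyc unfolding undirected_tree_def full by fastforce
  have nodes: "{t \<in> pverts T'. u \<in> X' t} = f ` {t \<in> pverts T. u \<in> X t}" for u
    by (auto simp: T'_def X'f)
  have "tree_decomposition G T' X'"
    using td tree' con unfolding tree_decomposition_def nodes
    by (simp add: T'_def X'f)
  moreover have "decomposition_alpha G T' X' = decomposition_alpha G T X"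
    by (simp add: decomposition_alpha_def T'_def image_image X'f cong: image_cong_simp)
  ultimately show ?thesis
    unfolding tree_alpha_def by (intro Least_le) metis
qed

end

theory Submission
  imports Defs
begin

text \<open>
  Deletions, contractions and isomorphisms all yield a family of pairwise disjoint connected branch
  sets \<open>B x\<close> in \<open>G\<close>, one for each vertex \<open>x\<close> of \<open>G'\<close>, such that distinct \<open>x\<close> and \<open>y\<close> are adjacent
  iff some arc joins \<open>B x\<close> to \<open>B y\<close>. Given a tree decomposition of \<open>G\<close> with bags \<open>X t\<close>, the bags
  \<open>{x. B x \<inter> X t \<noteq> {}}\<close> on the same tree decompose \<open>G'\<close>. Picking a representative of \<open>B x\<close> in
  \<open>X t\<close> for every \<open>x\<close> in an independent set of the new bag gives an independent set of the old bag
  of the same size.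
\<close>

section \<open>Connectedness of induced subgraphs\<close>

text \<open>A walk through \<open>B\<close> lifts to a walk through the union: inside each
  \<open>N b\<close> one moves freely, and a common element of \<open>N b\<close> and
  \<open>N c\<close> lets one cross over along an arc. In the application \<open>B\<close> is a
  branch set and \<open>N b\<close> consists of the nodes whose bag contains
  \<open>b\<close>.\<close>

lemma connected_induce_subgraph_UN:
  assumes con: "connected (G \<restriction> B)"
    and part: "\<And>b. b \<in> B \<Longrightarrow> connected (T \<restriction> N b)"
    and meet: "\<And>b c. b \<in> B \<Longrightarrow> c \<in> B \<Longrightarrow> (b, c) \<in> arcs_ends G \<Longrightarrow> N b \<inter> N c \<noteq> {}"
  shows "connected (T \<restriction> (\<Union>b\<in>B. N b))"
proof -
  let ?S = "\<Union>b\<in>B. N b"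
  let ?R = "rtrancl_on ?S (symcl (arcs_ends (T \<restriction> ?S)))"
  have inner: "(s, t) \<in> ?R" if "b \<in> B" "s \<in> N b" "t \<in> N b" for b s t
  proof -
    have "(s, t) \<in> rtrancl_on (N b) (symcl (arcs_ends (T \<restriction> N b)))"
      using part that by (auto simp: connected_conv)
    moreover have "arcs_ends (T \<restriction> N b) \<subseteq> arcs_ends (T \<restriction> ?S)"
      using that(1) by (auto simp: arcs_ends_conv)
    then have "symcl (arcs_ends (T \<restriction> N b)) \<subseteq> symcl (arcs_ends (T \<restriction> ?S))"
      by (auto simp: symcl_def)
    moreover have "N b \<subseteq> ?S"
      using that(1) by blast
    ultimately show ?thesis
      by (meson rtrancl_on_mono)
  qed
  have "(s, t) \<in> ?R" if s: "b \<in> B" "s \<in> N b" and t: "c \<in> B" "t \<in> N c" for b c s t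
  proof -
    have "(b, c) \<in> rtrancl_on B (symcl (arcs_ends (G \<restriction> B)))"
      using con s t by (auto simp: connected_conv)
    then show ?thesis
      using t(2)
    \<comment> \<open>The induction follows a walk in \<open>B\<close> starting at \<open>b\<close>.
      The target \<open>t\<close> is generalized so that the hypothesis can be used for the crossing
      point \<open>r\<close> below.\<close>
    proof (induction arbitrary: t rule: rtrancl_on_induct)
      case base
      then show ?case using inner s by blast
    next
      case (step c d)
      \<comment> \<open>\<open>G\<close> need not be symmetric here, so a step of the walk may
        traverse an arc backwards.\<close>
      then have cd: "c \<in> B" "d \<in> B" "(c, d) \<in> arcs_ends G \<or> (d, c) \<in> arcs_ends G"
        by (auto simp: symcl_def arcs_ends_conv)
      then obtain r where "r \<in> N c" "r \<in> N d"
        using meet by blast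
      then show ?case
        using step.IH inner[OF cd(2)] step.prems by (meson rtrancl_on_trans)
    qed
  qed
  moreover have "?S \<noteq> {}"
    using con part by (fastforce simp: connected_conv)
  ultimately show ?thesis
    by (auto simp: connected_conv)
qed

lemma connected_induce_subgraph_singleton: "connected (G \<restriction> {v})"
  by (auto simp: connected_conv)

lemma connected_induce_subgraph_pair:
  assumes "(u, v) \<in> arcs_ends G"
  shows "connected (G \<restriction> {u, v})"
proof -
  let ?r = "symcl (arcs_ends (G \<restriction> {u, v}))"
  have "(u, v) \<in> ?r" "(v, u) \<in> ?r"
    using assms by (auto simp: symcl_def arcs_ends_conv)
  then have "(u, v) \<in> rtrancl_on {u, v} ?r" "(v, u) \<in> rtrancl_on {u, v} ?r"
    by (auto intro: rtrancl_on_into_rtrancl_on)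
  then show ?thesis
    by (auto simp: connected_conv)
qed

lemma arcs_ends_with_proj_induce_subgraph:
  "arcs_ends (with_proj G \<restriction> S) = parcs G \<inter> S \<times> S"
  by (force simp: arcs_ends_conv)

section \<open>Bounds on the independence number\<close>

lemma finite_independent_sets: "finite (verts G) \<Longrightarrow> finite {S. independent_set G S}"
  by (rule finite_subset[of _ "Pow (verts G)"]) (auto simp: independent_set_def)

lemma card_le_independence_number:
  assumes "finite (verts G)" "independent_set G S"
  shows "card S \<le> independence_number G"
  unfolding independence_number_def using assms finite_independent_sets by (intro Max_ge) auto

lemma independence_number_le:
  assumes "finite (verts G)" "\<And>S. independent_set G S \<Longrightarrow> card S \<le> k"
  shows "independence_number G \<le> k"
proof -
  \<comment> \<open>This keeps the set under \<open>Max\<close> nonempty, even for an empty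
    graph.\<close>
  have "independent_set G {}"
    by (simp add: independent_set_def)
  then show ?thesis
    unfolding independence_number_def using assms finite_independent_sets
    by (subst Max_le_iff) auto
qed

section \<open>Induced minor models\<close>

text \<open>Vertices of \<open>G\<close> outside all branch sets are the deleted ones. The
  equivalence, in place of an implication, is what makes the minor induced. As its right side also
  restricts \<open>x\<close> and \<open>y\<close> to distinct vertices of \<open>G'\<close>, it
  fixes the arcs of \<open>G'\<close> completely and excludes loops coming from arcs inside a branch
  set.\<close>

definition induced_minor_model ::
    "'b pair_pre_digraph \<Rightarrow> 'a pair_pre_digraph \<Rightarrow> ('b \<Rightarrow> 'a set) \<Rightarrow> bool" where
  "induced_minor_model G' G B \<longleftrightarrow>
    (\<forall>x\<in>pverts G'. B x \<subseteq> pverts G \<and> connected (with_proj G \<restriction> B x)) \<and>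
    (\<forall>x\<in>pverts G'. \<forall>y\<in>pverts G'. x \<noteq> y \<longrightarrow> B x \<inter> B y = {}) \<and>
    (\<forall>x y. (x, y) \<in> parcs G' \<longleftrightarrow>
      x \<in> pverts G' \<and> y \<in> pverts G' \<and> x \<noteq> y \<and> (\<exists>a\<in>B x. \<exists>b\<in>B y. (a, b) \<in> parcs G))"

lemma induced_minor_modelD:
  assumes "induced_minor_model G' G B"
  shows "x \<in> pverts G' \<Longrightarrow> B x \<subseteq> pverts G"
    and "x \<in> pverts G' \<Longrightarrow> connected (with_proj G \<restriction> B x)"
    and "x \<in> pverts G' \<Longrightarrow> y \<in> pverts G' \<Longrightarrow> x \<noteq> y \<Longrightarrow> B x \<inter> B y = {}"
  using assms by (simp_all add: induced_minor_model_def)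

lemma induced_minor_model_arc_iff:
  assumes "induced_minor_model G' G B"
  shows "(x, y) \<in> parcs G' \<longleftrightarrow>
    x \<in> pverts G' \<and> y \<in> pverts G' \<and> x \<noteq> y \<and> (\<exists>a\<in>B x. \<exists>b\<in>B y. (a, b) \<in> parcs G)"
  using assms by (simp add: induced_minor_model_def)

lemma induced_minor_model_nonempty:
  "induced_minor_model G' G B \<Longrightarrow> x \<in> pverts G' \<Longrightarrow> B x \<noteq> {}"
  using induced_minor_modelD(2)[of G' G B x] by (simp add: connected_conv)

text \<open>Finiteness and symmetry are inherited from \<open>G\<close>, the other graph properties
  are part of the arc condition. This allows steps to be iterated and spares a separate assumption
  on \<open>G'\<close>.\<close>

lemma pair_graph_induced_minor_model:
  assumes "pair_graph G" and B: "induced_minor_model G' G B"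
  shows "pair_graph G'"
proof -
  interpret G: pair_graph G by fact
  note arc = induced_minor_model_arc_iff[OF B]
  \<comment> \<open>Disjoint nonempty sets are distinct, so \<open>B\<close> embeds the vertices of
    \<open>G'\<close> into the finite power set of \<open>pverts G\<close>.\<close>
  have "inj_on B (pverts G')"
  proof (rule inj_onI, rule ccontr)
    fix x y assume xy: "x \<in> pverts G'" "y \<in> pverts G'" "B x = B y" "x \<noteq> y"
    then show False
      using induced_minor_modelD(3)[OF B, of x y] induced_minor_model_nonempty[OF B] by simp
  qed
  moreover have "finite (B ` pverts G')"
    by (rule finite_subset[of _ "Pow (pverts G)"])
      (use induced_minor_modelD(1)[OF B] in \<open>auto simp: G.pair_finite_verts\<close>)
  ultimately have fin: "finite (pverts G')"
    using finite_imageD by blast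
  have "parcs G' \<subseteq> pverts G' \<times> pverts G'"
    by (auto simp: arc)
  then have "finite (parcs G')"
    using fin finite_subset by blast
  moreover have "symmetric (with_proj G')"
    unfolding symmetric_def
  proof (rule symI)
    fix x y assume "(x, y) \<in> arcs_ends (with_proj G')"
    then have "(x, y) \<in> parcs G'"
      by simp
    then have "(y, x) \<in> parcs G'"
      using G.arcs_symmetric unfolding arc by blast
    then show "(y, x) \<in> arcs_ends (with_proj G')"
      by simp
  qed
  ultimately show ?thesis
    using fin by unfold_locales (auto simp: arc)
qed

section \<open>Transfer of tree decompositions along a model\<close>

lemma tree_decomposition_induced_minor_model:
  assumes B: "induced_minor_model G' G B" and td: "tree_decomposition G T X"
  shows "tree_decomposition G' T (\<lambda>t. {x \<in> pverts G'. B x \<inter> X t \<noteq> {}})"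
proof -
  have con: "connected (with_proj T \<restriction> {t \<in> pverts T. B x \<inter> X t \<noteq> {}})" if x: "x \<in> pverts G'" for x
  proof -
    \<comment> \<open>The nodes whose bag meets \<open>B x\<close> form the union of the subtrees of
      the vertices in \<open>B x\<close>; subtrees of adjacent vertices intersect because every edge
      lies in a bag.\<close>
    have "connected (with_proj T \<restriction> (\<Union>b\<in>B x. {t \<in> pverts T. b \<in> X t}))"
    proof (rule connected_induce_subgraph_UN)
      show "connected (with_proj G \<restriction> B x)"
        using B x by (rule induced_minor_modelD)
      show "connected (with_proj T \<restriction> {t \<in> pverts T. b \<in> X t})" if "b \<in> B x" for b
        using induced_minor_modelD(1)[OF B x] td that unfolding tree_decomposition_def by blast
      show "{t \<in> pverts T. b \<in> X t} \<inter> {t \<in> pverts T. c \<in> X t} \<noteq> {}"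
        if "(b, c) \<in> arcs_ends (with_proj G)" for b c
        using td that by (fastforce simp: tree_decomposition_def)
    qed
    moreover have "(\<Union>b\<in>B x. {t \<in> pverts T. b \<in> X t}) = {t \<in> pverts T. B x \<inter> X t \<noteq> {}}"
      by blast
    ultimately show ?thesis by simp
  qed
  have edge: "\<exists>t\<in>pverts T. B x \<inter> X t \<noteq> {} \<and> B y \<inter> X t \<noteq> {}" if xy: "(x, y) \<in> parcs G'" for x y
  proof -
    obtain a b where ab: "a \<in> B x" "b \<in> B y" "(a, b) \<in> parcs G"
      using xy unfolding induced_minor_model_arc_iff[OF B] by blast
    then obtain t where "t \<in> pverts T" "a \<in> X t" "b \<in> X t"
      using td by (fastforce simp: tree_decomposition_def)
    then show ?thesis using ab by blast
  qed
  \<comment> \<open>Connectedness includes nonemptiness, so covering of vertices comes for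
    free.\<close>
  have vert: "\<exists>t\<in>pverts T. B x \<inter> X t \<noteq> {}" if "x \<in> pverts G'" for x
    using con[OF that] by (auto simp: connected_conv)
  have ends: "x \<in> pverts G' \<and> y \<in> pverts G'" if "(x, y) \<in> parcs G'" for x y
    using that unfolding induced_minor_model_arc_iff[OF B] by blast
  show ?thesis
    unfolding tree_decomposition_def
  proof (intro conjI ballI)
    show "undirected_tree T"
      using td by (simp add: tree_decomposition_def)
  next
    fix x assume "x \<in> pverts G'"
    then show "\<exists>t\<in>pverts T. x \<in> {x \<in> pverts G'. B x \<inter> X t \<noteq> {}}"
      and "connected (with_proj T \<restriction> {t \<in> pverts T. x \<in> {x \<in> pverts G'. B x \<inter> X t \<noteq> {}}})"
      using vert con by simp_all
  next
    fix e assume "e \<in> parcs G'"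
    then show "case e of (x, y) \<Rightarrow> \<exists>t\<in>pverts T. x \<in> {x \<in> pverts G'. B x \<inter> X t \<noteq> {}}
        \<and> y \<in> {x \<in> pverts G'. B x \<inter> X t \<noteq> {}}"
      using edge ends by (cases e) simp
  qed blast
qed

lemma decomposition_alpha_induced_minor_model_le:
  assumes "pair_graph G" and B: "induced_minor_model G' G B" and td: "tree_decomposition G T X"
  shows "decomposition_alpha G' T (\<lambda>t. {x \<in> pverts G'. B x \<inter> X t \<noteq> {}}) \<le> decomposition_alpha G T X"
proof -
  interpret G: pair_graph G by fact
  interpret G': pair_graph G'
    using assms(1) B by (rule pair_graph_induced_minor_model)
  have "pair_graph T" "connected (with_proj T)"
    using td by (auto simp: tree_decomposition_def undirected_tree_def)
  then have T: "finite (pverts T)" "pverts T \<noteq> {}"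
    by (auto simp: connected_conv pair_graph_def pair_digraph_def pair_fin_digraph_def pair_fin_digraph_axioms_def)
  have alpha: "independence_number (with_proj G' \<restriction> {x \<in> pverts G'. B x \<inter> X t \<noteq> {}})
      \<le> independence_number (with_proj G \<restriction> X t)" if t: "t \<in> pverts T" for t
  proof (rule independence_number_le)
    fix S assume S: "independent_set (with_proj G' \<restriction> {x \<in> pverts G'. B x \<inter> X t \<noteq> {}}) S"
    then have S': "x \<in> pverts G'" "B x \<inter> X t \<noteq> {}" if "x \<in> S" for x
      using that by (auto simp: independent_set_def)
    then have "\<forall>x\<in>S. \<exists>a. a \<in> B x \<and> a \<in> X t"
      by blast
    then obtain r where r: "\<And>x. x \<in> S \<Longrightarrow> r x \<in> B x \<and> r x \<in> X t"
      by metis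
    \<comment> \<open>A shared representative would lie in two disjoint branch sets.\<close>
    have inj: "inj_on r S"
    proof (rule inj_onI, rule ccontr)
      fix x y assume "x \<in> S" "y \<in> S" "r x = r y" "x \<noteq> y"
      then show False
        using induced_minor_modelD(3)[OF B, of x y] S'(1) r[of x] r[of y] by auto
    qed
    \<comment> \<open>An arc between representatives joins two branch sets, which are different
      since \<open>G\<close> has no loops, and so yields an arc of \<open>G'\<close> inside
      \<open>S\<close>.\<close>
    have nonadj: "(r x, r y) \<notin> parcs G" if xy: "x \<in> S" "y \<in> S" for x y
    proof
      assume a: "(r x, r y) \<in> parcs G"
      then have "x \<noteq> y"
        using G.no_loops' by blast
      then have "(x, y) \<in> parcs G'"
        using a S'(1) r xy unfolding induced_minor_model_arc_iff[OF B] by blast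
      then show False
        using S S' xy by (auto simp: independent_set_def arcs_ends_with_proj_induce_subgraph)
    qed
    have "independent_set (with_proj G \<restriction> X t) (r ` S)"
      using r nonadj by (auto simp: independent_set_def arcs_ends_with_proj_induce_subgraph)
    moreover have "finite (X t)"
      using td t by (intro finite_subset[OF _ G.pair_finite_verts]) (simp add: tree_decomposition_def)
    ultimately show "card S \<le> independence_number (with_proj G \<restriction> X t)"
      using card_le_independence_number[of "with_proj G \<restriction> X t" "r ` S"] card_image[OF inj] by simp
  qed simp
  show ?thesis
    unfolding decomposition_alpha_def
  proof (rule Max.boundedI)
    fix k assume "k \<in> (\<lambda>t. independence_number (with_proj G' \<restriction> {x \<in> pverts G'. B x \<inter> X t \<noteq> {}})) ` pverts T"
    then obtain t where "t \<in> pverts T" "k \<le> independence_number (with_proj G \<restriction> X t)"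
      using alpha by blast
    then show "k \<le> Max ((\<lambda>t. independence_number (with_proj G \<restriction> X t)) ` pverts T)"
      using T(1) by (meson Max_ge finite_imageI imageI le_trans)
  qed (use T in auto)
qed

lemma tree_alpha_induced_minor_model_le:
  assumes "pair_graph G" "induced_minor_model G' G B"
  shows "tree_alpha G' \<le> tree_alpha G"
proof -
  \<comment> \<open>An optimal decomposition of \<open>G\<close>; its transfer along the model
    competes in the minimum defining \<open>tree_alpha G'\<close>.\<close>
  obtain T :: "nat pair_pre_digraph" and X
    where td: "tree_decomposition G T X" "tree_alpha G = decomposition_alpha G T X"
    using tree_alpha_attained[OF assms(1)] by blast
  show ?thesis
    unfolding td(2)
    using tree_alpha_le[OF tree_decomposition_induced_minor_model[OF assms(2) td(1)]]
      decomposition_alpha_induced_minor_model_le[OF assms td(1)]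
    by (rule le_trans)
qed

section \<open>Models from deletions, contractions and isomorphisms\<close>

lemma induced_minor_model_delete_vertex:
  assumes "pair_graph G"
  shows "induced_minor_model (delete_vertex G v) G (\<lambda>x. {x})"
proof -
  interpret G: pair_graph G by fact
  show ?thesis
    by (auto simp: induced_minor_model_def delete_vertex_def connected_induce_subgraph_singleton
        dest: G.in_arcsD1 G.in_arcsD2 G.no_loops')
qed

lemma induced_minor_model_contract_edge:
  assumes "pair_graph G" and uv: "(u, v) \<in> parcs G" and w: "w \<notin> pverts G - {u, v}"
  shows "induced_minor_model (contract_edge G u v w) G (\<lambda>x. if x = w then {u, v} else {x})"
proof -
  interpret G: pair_graph G by fact
  let ?K = "contract_edge G u v w" and ?B = "\<lambda>x. if x = w then {u, v} else {x}"
  have "connected (with_proj G \<restriction> {u, v})"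
    using uv by (intro connected_induce_subgraph_pair) simp
  then have "\<forall>x\<in>pverts ?K. ?B x \<subseteq> pverts G \<and> connected (with_proj G \<restriction> ?B x)"
    using G.in_arcsD1[OF uv] G.in_arcsD2[OF uv]
    by (auto simp: contract_edge_def connected_induce_subgraph_singleton)
  moreover have "\<forall>x\<in>pverts ?K. \<forall>y\<in>pverts ?K. x \<noteq> y \<longrightarrow> ?B x \<inter> ?B y = {}"
    by (auto simp: contract_edge_def)
  moreover have "(x, y) \<in> parcs ?K \<longleftrightarrow>
      x \<in> pverts ?K \<and> y \<in> pverts ?K \<and> x \<noteq> y \<and> (\<exists>a\<in>?B x. \<exists>b\<in>?B y. (a, b) \<in> parcs G)" for x y
  proof -
    have V: "a \<in> pverts G \<and> b \<in> pverts G \<and> a \<noteq> b" if "(a, b) \<in> parcs G" for a b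
      using that G.in_arcsD1 G.in_arcsD2 G.no_loops' by blast
    \<comment> \<open>\<open>neighbours\<close> collects heads of outgoing arcs; symmetry is what
      describes the arcs into \<open>w\<close> by the same sets.\<close>
    have sym: "(a, b) \<in> parcs G \<longleftrightarrow> (b, a) \<in> parcs G" for a b
      using G.arcs_symmetric by blast
    show ?thesis
      \<comment> \<open>The choice of \<open>w\<close> ensures that no arc between remaining
        vertices touches \<open>w\<close> and that \<open>w\<close> is not among its own new
        neighbours.\<close>
      using w V by (cases "x = w"; cases "y = w")
        (auto simp: contract_edge_def neighbours_def sym)
  qed
  ultimately show ?thesis
    by (simp add: induced_minor_model_def)
qed

lemma induced_minor_step_model:
  assumes "pair_graph G" "induced_minor_step G H"
  shows "\<exists>B. induced_minor_model H G B"
  using assms(2)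
proof cases
  case (deletion v)
  then show ?thesis
    using induced_minor_model_delete_vertex[OF assms(1)] by blast
next
  case (contraction u v w)
  then show ?thesis
    using induced_minor_model_contract_edge[OF assms(1)] by blast
qed

text \<open>The branch sets are the fibres of the vertex map, which are singletons by
  injectivity.\<close>

lemma induced_minor_model_digraph_iso:
  assumes "pair_graph H" "digraph_iso (with_proj H) (with_proj G')"
  shows "\<exists>B. induced_minor_model G' H B"
proof -
  interpret H: pair_graph H by fact
  obtain h where h: "H.digraph_isomorphism h" and G': "with_proj G' = app_iso h (with_proj H)"
    using assms(2) by (auto simp: digraph_iso_def)
  define f where "f = iso_verts h"
  have inj: "inj_on f (pverts H)"
    using h by (simp add: f_def H.digraph_isomorphism_def)
  have verts: "pverts G' = f ` pverts H"
    using arg_cong[OF G', of verts] by (simp add: f_def)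
  \<comment> \<open>An isomorphism carries a separate map on arcs. Passing to end pairs, which are
    the arcs themselves in both graphs, leaves only the vertex map \<open>f\<close>.\<close>
  have "arcs_ends (with_proj G') = map_prod f f ` arcs_ends (with_proj H)"
    using H.arcs_ends_app_iso_eq[OF h] unfolding G' by (auto simp: f_def)
  then have arcs: "parcs G' = map_prod f f ` parcs H"
    by simp
  have B: "{a \<in> pverts H. f a = f b} = {b}" if "b \<in> pverts H" for b
    using inj that by (auto dest: inj_onD)
  have "induced_minor_model G' H (\<lambda>y. {a \<in> pverts H. f a = y})"
    unfolding induced_minor_model_def
  proof (intro conjI allI)
    show "\<forall>y\<in>pverts G'. {a \<in> pverts H. f a = y} \<subseteq> pverts H
        \<and> connected (with_proj H \<restriction> {a \<in> pverts H. f a = y})"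
      by (auto simp: verts B connected_induce_subgraph_singleton)
    show "\<forall>x\<in>pverts G'. \<forall>y\<in>pverts G'. x \<noteq> y \<longrightarrow>
        {a \<in> pverts H. f a = x} \<inter> {a \<in> pverts H. f a = y} = {}"
      by blast
    fix x y
    show "(x, y) \<in> parcs G' \<longleftrightarrow> x \<in> pverts G' \<and> y \<in> pverts G' \<and> x \<noteq> y \<and>
        (\<exists>a\<in>{a \<in> pverts H. f a = x}. \<exists>b\<in>{a \<in> pverts H. f a = y}. (a, b) \<in> parcs H)"
    proof
      assume "(x, y) \<in> parcs G'"
      then obtain a b where ab: "(a, b) \<in> parcs H" "x = f a" "y = f b"
        by (auto simp: arcs)
      moreover have "a \<in> pverts H" "b \<in> pverts H" "a \<noteq> b"
        using ab(1) H.in_arcsD1 H.in_arcsD2 H.no_loops' by blast+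
      ultimately show "x \<in> pverts G' \<and> y \<in> pverts G' \<and> x \<noteq> y \<and>
          (\<exists>a\<in>{a \<in> pverts H. f a = x}. \<exists>b\<in>{a \<in> pverts H. f a = y}. (a, b) \<in> parcs H)"
        using inj by (auto simp: verts inj_on_eq_iff)
    qed (force simp: arcs)
  qed
  then show ?thesis by blast
qed

theorem proposition3p9:
  fixes G :: "'a pair_pre_digraph" and G' :: "'b pair_pre_digraph"
  assumes "pair_graph G" and "induced_minor G' G"
  shows "tree_alpha G' \<le> tree_alpha G"
proof -
  obtain H where GH: "induced_minor_step\<^sup>*\<^sup>* G H" and iso: "digraph_iso (with_proj H) (with_proj G')"
    using assms(2) by (auto simp: induced_minor_def)
  \<comment> \<open>Models of single steps suffice: the inequalities are chained, so models never
    have to be composed. \<open>pair_graph H\<close> is carried along to supply the hypothesis of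
    the next step.\<close>
  from GH have H: "pair_graph H \<and> tree_alpha H \<le> tree_alpha G"
  proof induction
    case base
    then show ?case using assms(1) by simp
  next
    case (step H K)
    then obtain B where "induced_minor_model K H B"
      using induced_minor_step_model by blast
    then show ?case
      using step.IH pair_graph_induced_minor_model tree_alpha_induced_minor_model_le le_trans by blast
  qed
  moreover obtain B where "induced_minor_model G' H B"
    using induced_minor_model_digraph_iso[OF _ iso] H by blast
  ultimately show ?thesis
    using tree_alpha_induced_minor_model_le le_trans by blast
qed

end
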